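(* Let $\lambda>1/2$. Then there exists a positive constant $f(\lambda)$ such that, in the $N$-balanced model, $\mathrm{err}_N(G_{n,\lambda n})\geq f(\lambda)$ with high probability as $n$ grows; that is, for every $\epsilon>0$ there exists $M$ such that $\mathbb{P}\big(\mathrm{err}_N(G_{n,\lambda n})\geq f(\lambda)\big)\geq 1-\epsilon$ for all $N\geq 1$ and all $n\geq M$.
   Context: $G_{n,m}$ denotes a uniformly random simple graph with vertex set $\{1,\dots,n\}$ and $m$ edges; $G_{n,\lambda n}$ means $m=\lambda n$ (rounded down to an integer). CU-process on a graph $G=(V,E)$: each vertex $v$ carries a counter $c_v$ with initial value $0$. At each step an edge $e=\{u,v\}\in E$ is drawn, and those of the counters $c_u,c_v$ that equal $\min(c_u,c_v)$ (values before the step) are simultaneously incremented by $1$; all other counters do not change. $c_v(t)$ is the value of $c_v$ after $t$ steps, and for an edge $e=\{u,v\}$, $c_e(t)=\min(c_u(t),c_v(t))$. $N$-balanced model ($N\geq 1$ an integer, $m=|E|$): the sequence of $Nm$ drawn edges is a uniformly random permutation of the multiset containing $N$ copies of each edge of $E$. Set $c_e^{(N)}=c_e(Nm)$; the relative error of $e$ is $R_e^{(N)}=(c_e^{(N)}-N)/N$, and the average error is $\mathrm{err}_N(G)=\frac1m\sum_{e\in E}R_e^{(N)}$. Probability is over both the random graph and the random sequence. *)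

theory Defs
  imports
    "HOL-Probability.Probability"
    "HOL-Combinatorics.Multiset_Permutations"
    "HOL-Library.Ramsey"
begin

(* Simple graphs on V are given by their edge sets: subsets of nsets V 2,
   the set of two-element subsets of V. *)
definition graphs_with_edges :: "'v set \<Rightarrow> nat \<Rightarrow> 'v set set set" where
  "graphs_with_edges V m = {E. E \<subseteq> nsets V 2 \<and> card E = m}"

(* Meaningful only when m \<le> n choose 2: pmf_of_set is unspecified on the empty set. *)
definition random_graph :: "nat \<Rightarrow> nat \<Rightarrow> nat set set pmf" where
  "random_graph n m = pmf_of_set (graphs_with_edges {1..n} m)"

definition edge_min :: "('v \<Rightarrow> nat) \<Rightarrow> 'v set \<Rightarrow> nat" where
  "edge_min c e = Min (c ` e)"

lemma edge_min_doubleton: "edge_min c {u, v} = min (c u) (c v)"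
  by (simp add: edge_min_def)

definition cu_step :: "'v set \<Rightarrow> ('v \<Rightarrow> nat) \<Rightarrow> ('v \<Rightarrow> nat)" where
  "cu_step e c = (\<lambda>v. if v \<in> e \<and> c v = edge_min c e then c v + 1 else c v)"

(* Counters after the first t steps, for the sequence es of drawn edges. *)
definition counters :: "'v set list \<Rightarrow> nat \<Rightarrow> 'v \<Rightarrow> nat" where
  "counters es t = fold cu_step (take t es) (\<lambda>_. 0)"

definition edge_counter :: "'v set list \<Rightarrow> nat \<Rightarrow> 'v set \<Rightarrow> nat" where
  "edge_counter es t e = edge_min (counters es t) e"

definition balanced_sequence :: "nat \<Rightarrow> 'v set set \<Rightarrow> 'v set list pmf" where
  "balanced_sequence N E =
     pmf_of_set (permutations_of_multiset (repeat_mset N (mset_set E)))"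

definition rel_error :: "nat \<Rightarrow> 'v set set \<Rightarrow> 'v set list \<Rightarrow> 'v set \<Rightarrow> real" where
  "rel_error N E es e = (real (edge_counter es (N * card E) e) - real N) / real N"

definition avg_error :: "nat \<Rightarrow> 'v set set \<Rightarrow> 'v set list \<Rightarrow> real" where
  "avg_error N E es = (\<Sum>e\<in>E. rel_error N E es e) / real (card E)"

(* Joint law of the random graph and the random sequence of its edges. *)
definition balanced_model :: "nat \<Rightarrow> nat \<Rightarrow> nat \<Rightarrow> (nat set set \<times> nat set list) pmf" where
  "balanced_model N n m =
     bind_pmf (random_graph n m) (\<lambda>E. map_pmf (Pair E) (balanced_sequence N E))"

end

theory Submission
  imports Defs "HOL-Real_Asymp.Real_Asymp"
begin

text \<open>
  Every draw of an edge inside a vertex set \<open>S\<close> increments a counter in \<open>S\<close>, so the counters in \<open>S\<close>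
  add up to at least \<open>N e(S)\<close>. Since every positive \<open>c\<^sub>v\<close> is dominated by \<open>c\<^sub>e\<close> for some edge \<open>e\<close> at \<open>v\<close>,
  and every \<open>c\<^sub>e\<close> is at least \<open>N\<close>, the average error is at least \<open>(e(S) - |S|) / (2 m)\<close>, whatever
  the sequence of draws. It remains to find, with high probability, a set \<open>S\<close> of linear excess
  \<open>e(S) - |S|\<close>.

  This is a first-moment argument. A graph without such an \<open>S\<close> is, up to few edges and up to the
  components of bounded size, a forest. Exploring the graph vertex by vertex bounds the weighted
  number of forests on \<open>n\<close> vertices by \<open>n! (e w)\<^sup>n exp (1 / (2 w))\<close>. Compared with the number of
  all graphs with \<open>m = \<lambda> n\<close> edges, for \<open>w = s / n\<close> and \<open>s = 2 \<lambda>\<close>, this gives the exponential rate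
  \<open>ln s + 1 / (2 s) - s / 2\<close>, which is negative for \<open>s > 1\<close>.
\<close>

section \<open>The error is at least the excess\<close>

lemma edge_min_le: "finite e \<Longrightarrow> v \<in> e \<Longrightarrow> edge_min c e \<le> c v"
  by (simp add: edge_min_def)

lemma edge_min_ge_iff: "finite e \<Longrightarrow> e \<noteq> {} \<Longrightarrow> a \<le> edge_min c e \<longleftrightarrow> (\<forall>v\<in>e. a \<le> c v)"
  by (simp add: edge_min_def)

lemma cu_step_ge: "c v \<le> cu_step e c v"
  by (simp add: cu_step_def)

lemma edge_min_mono:
  "finite e \<Longrightarrow> e \<noteq> {} \<Longrightarrow> (\<And>v. c v \<le> c' v) \<Longrightarrow> edge_min c e \<le> edge_min c' e"
  using edge_min_ge_iff edge_min_le by (meson le_trans)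

lemma edge_min_cu_step_self:
  assumes "finite e" "e \<noteq> {}"
  shows "edge_min c e + 1 \<le> edge_min (cu_step e c) e"
  unfolding edge_min_ge_iff[OF assms]
  using edge_min_le[OF assms(1), of _ c]
  by (force simp: cu_step_def)

text \<open>A draw of \<open>e\<close> itself raises every minimal counter on \<open>e\<close>,
  hence the minimum by at least one; other draws never lower it. This gives edge counters of at
  least \<open>N\<close> in the balanced model.\<close>

lemma edge_min_fold_cu_step_ge:
  assumes "finite e" "e \<noteq> {}"
  shows "edge_min c e + count (mset es) e \<le> edge_min (fold cu_step es c) e"
proof (induction es arbitrary: c)
  case (Cons a es)
  have "edge_min c e + (if a = e then 1 else 0) \<le> edge_min (cu_step a c) e"
    using edge_min_cu_step_self[OF assms, of c] edge_min_mono[OF assms, of c "cu_step a c"]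
    by (cases "a = e") (simp_all add: cu_step_ge)
  with Cons.IH[of "cu_step a c"] show ?case by (auto split: if_splits)
qed simp

lemma sum_cu_step_ge:
  assumes "finite S" "e \<noteq> {}" "e \<subseteq> S"
  shows "sum c S + 1 \<le> sum (cu_step e c) S"
proof -
  have "finite e" using assms finite_subset by blast
  then have "edge_min c e \<in> c ` e" unfolding edge_min_def using assms by simp
  then obtain v where v: "v \<in> e" "c v = edge_min c e" by force
  then have "c v < cu_step e c v" by (simp add: cu_step_def)
  then have "sum c S < sum (cu_step e c) S"
    using v assms by (intro sum_strict_mono_ex1 bexI[of _ v]) (auto simp: cu_step_ge)
  then show ?thesis by simp
qed

lemma sum_fold_cu_step_ge:
  assumes "finite S" "{} \<notin> set es"
  shows "sum c S + length (filter (\<lambda>e. e \<subseteq> S) es) \<le> sum (fold cu_step es c) S"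
  using assms(2)
proof (induction es arbitrary: c)
  case (Cons a es)
  have "sum c S + (if a \<subseteq> S then 1 else 0) \<le> sum (cu_step a c) S"
    using sum_cu_step_ge[OF assms(1), of a c] Cons.prems sum_mono[of S c "cu_step a c"]
    by (auto simp: cu_step_ge)
  with Cons.IH[of "cu_step a c"] Cons.prems show ?case by auto
qed simp

text \<open>Right after \<open>v\<close> is incremented along \<open>e\<close>, its counter is minimal on \<open>e\<close>, and it
  stays below the edge counter of \<open>e\<close> until it is incremented again.\<close>

lemma fold_cu_step_dominating_edge:
  assumes "\<And>e. e \<in> F \<Longrightarrow> finite e \<and> e \<noteq> {}" "set es \<subseteq> F"
    and "\<forall>v. c v > 0 \<longrightarrow> (\<exists>e\<in>F. v \<in> e \<and> c v \<le> edge_min c e)"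
  shows "\<forall>v. fold cu_step es c v > 0 \<longrightarrow>
           (\<exists>e\<in>F. v \<in> e \<and> fold cu_step es c v \<le> edge_min (fold cu_step es c) e)"
  using assms(2,3)
proof (induction es arbitrary: c)
  case (Cons a es)
  let ?c = "cu_step a c"
  have a: "a \<in> F" "finite a" "a \<noteq> {}" using Cons.prems assms(1) by auto
  have "\<exists>e\<in>F. v \<in> e \<and> ?c v \<le> edge_min ?c e" if v: "?c v > 0" for v
  proof (cases "v \<in> a \<and> c v = edge_min c a")
    case True
    then show ?thesis
      using edge_min_cu_step_self[OF a(2,3), of c] a(1) by (intro bexI[of _ a]) (auto simp: cu_step_def)
  next
    case False
    then have eq: "?c v = c v" by (auto simp: cu_step_def)
    with v Cons.prems(2) obtain e where e: "e \<in> F" "v \<in> e" "c v \<le> edge_min c e" by auto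
    have "edge_min c e \<le> edge_min ?c e"
      using assms(1)[OF e(1)] by (intro edge_min_mono) (auto simp: cu_step_ge)
    then show ?thesis using e eq by (intro bexI[of _ e]) auto
  qed
  then show ?case using Cons.IH[of ?c] Cons.prems by auto
qed simp

lemma size_filter_repeat_mset:
  "size (filter_mset P (repeat_mset N A)) = N * size (filter_mset P A)"
  by (induction N) auto

text \<open>Charge each vertex of \<open>S\<close> with positive counter to a dominating edge at it.
  An edge gets at most two charges, one per endpoint, whence the factor 2; uncharged edges do no
  harm because every edge counter is at least \<open>N\<close>.\<close>

lemma avg_error_ge_excess:
  fixes E :: "'v set set"
  assumes fin: "finite E" and card2: "\<And>e. e \<in> E \<Longrightarrow> card e = 2" and N: "N \<ge> 1"
    and es: "es \<in> permutations_of_multiset (repeat_mset N (mset_set E))" and S: "finite S"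
  shows "(real (card {e\<in>E. e \<subseteq> S}) - real (card S)) / (2 * real (card E)) \<le> avg_error N E es"
proof -
  have mset: "mset es = repeat_mset N (mset_set E)"
    using es by (simp add: permutations_of_multiset_def)
  have "length es = N * card E"
    using arg_cong[OF mset, of size] by simp
  define c where "c = fold cu_step es (\<lambda>_. 0)"
  have counters: "counters es (N * card E) = c"
    by (simp add: counters_def c_def \<open>length es = N * card E\<close>[symmetric])
  have setes: "set es = E"
    proof -
    have "e \<in> set es \<longleftrightarrow> count (mset es) e > 0" for e by simp
    then show ?thesis unfolding mset using N fin by (auto split: if_splits)
  qed
  have fe: "finite e \<and> e \<noteq> {}" if "e \<in> E" for e
    using card2[OF that] by (metis card.empty card.infinite zero_neq_numeral)
  have ce: "N \<le> edge_min c e" if "e \<in> E" for e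
    using edge_min_fold_cu_step_ge[of e "\<lambda>_. 0" es] fe[OF that] that mset fin
    by (simp add: c_def)
  have "length (filter (\<lambda>e. e \<subseteq> S) es) = size (filter_mset (\<lambda>e. e \<subseteq> S) (mset es))"
    by (metis mset_filter size_mset)
  also have "\<dots> = N * card {e\<in>E. e \<subseteq> S}"
    by (simp add: mset size_filter_repeat_mset filter_mset_mset_set fin)
  finally have cS: "N * card {e\<in>E. e \<subseteq> S} \<le> sum c S"
    using sum_fold_cu_step_ge[OF S, of es "\<lambda>_. 0"] setes fe by (auto simp: c_def)
  \<comment> \<open>Vertices with counter 0 may have no dominating edge; each contributes
    \<open>- N\<close>, so dropping them cannot decrease the sum.\<close>
  define S' where "S' = {v\<in>S. c v > 0}"
  have "\<forall>v\<in>S'. \<exists>e\<in>E. v \<in> e \<and> c v \<le> edge_min c e"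
    using fold_cu_step_dominating_edge[of E es "\<lambda>_. 0"] fe setes by (auto simp: S'_def c_def)
  then obtain \<phi> where \<phi>: "\<And>v. v \<in> S' \<Longrightarrow> \<phi> v \<in> E \<and> v \<in> \<phi> v \<and> c v \<le> edge_min c (\<phi> v)"
    by metis
  have fS': "finite S'" using S by (simp add: S'_def)
  define h where "h e = real (edge_min c e) - real N" for e
  have h0: "0 \<le> h e" if "e \<in> E" for e using ce[OF that] by (simp add: h_def)
  have "real N * (real (card {e\<in>E. e \<subseteq> S}) - real (card S)) \<le> (\<Sum>v\<in>S. real (c v) - real N)"
    using cS by (simp add: sum_subtractf algebra_simps flip: of_nat_mult of_nat_sum)
  also have "\<dots> \<le> (\<Sum>v\<in>S'. real (c v) - real N)"
  proof -
    have "S = S' \<union> {v\<in>S. c v = 0}" by (auto simp: S'_def)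
    then have "(\<Sum>v\<in>S. real (c v) - real N)
        = (\<Sum>v\<in>S'. real (c v) - real N) + (\<Sum>v\<in>{v\<in>S. c v = 0}. real (c v) - real N)"
      using S by (subst sum.union_disjoint[symmetric]) (auto simp: S'_def)
    also have "(\<Sum>v\<in>{v\<in>S. c v = 0}. real (c v) - real N) \<le> 0"
      by (intro sum_nonpos) auto
    finally show ?thesis by simp
  qed
  also have "\<dots> \<le> (\<Sum>v\<in>S'. h (\<phi> v))"
    using \<phi> by (intro sum_mono) (simp add: h_def)
  also have "\<dots> = (\<Sum>e\<in>E. \<Sum>v\<in>{v\<in>S'. \<phi> v = e}. h (\<phi> v))"
    using \<phi> fin fS' by (intro sum.group[symmetric]) auto
  also have "\<dots> = (\<Sum>e\<in>E. real (card {v\<in>S'. \<phi> v = e}) * h e)"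
    by (intro sum.cong) auto
  also have "\<dots> \<le> (\<Sum>e\<in>E. 2 * h e)"
  proof (intro sum_mono mult_right_mono h0)
    fix e assume e: "e \<in> E"
    have "card {v\<in>S'. \<phi> v = e} \<le> card e"
      using fe[OF e] \<phi> by (intro card_mono) auto
    then show "real (card {v\<in>S'. \<phi> v = e}) \<le> 2" using card2[OF e] by simp
  qed
  finally have "real N * (real (card {e\<in>E. e \<subseteq> S}) - real (card S)) \<le> 2 * (\<Sum>e\<in>E. h e)"
    by (simp add: sum_distrib_left)
  moreover have "avg_error N E es = (\<Sum>e\<in>E. h e) / real N / real (card E)"
    by (simp add: avg_error_def rel_error_def edge_counter_def counters h_def sum_divide_distrib)
  ultimately have "real N * (real (card {e\<in>E. e \<subseteq> S}) - real (card S))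
      \<le> real N * (2 * real (card E) * avg_error N E es)" if "card E \<noteq> 0"
    using that N by simp
  then have "real (card {e\<in>E. e \<subseteq> S}) - real (card S) \<le> 2 * real (card E) * avg_error N E es"
    if "card E \<noteq> 0"
    using that N by simp
  \<comment> \<open>Without edges both sides of the claim are 0, as division by 0 yields 0.\<close>
  moreover have "card E = 0 \<Longrightarrow> avg_error N E es = 0" by (simp add: avg_error_def)
  ultimately show ?thesis
    using N by (cases "card E = 0") (auto simp: field_simps)
qed

section \<open>Weighted counting of forests\<close>

text \<open>The total weight, with weight \<open>w\<close> per edge, of the forests that an exploration with \<open>q\<close> queued
  and \<open>r\<close> unseen vertices can still reveal: a queued vertex picks its \<open>d\<close> children among the unseen
  ones, and an empty queue is refilled with an unseen vertex.\<close>

function forest_weight :: "real \<Rightarrow> nat \<Rightarrow> nat \<Rightarrow> real" where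
  "forest_weight w 0 0 = 1"
| "forest_weight w 0 (Suc r) = forest_weight w 1 r"
| "forest_weight w (Suc q) r =
     (\<Sum>d\<le>r. real (r choose d) * w ^ d * forest_weight w (q + d) (r - d))"
  by pat_completeness auto
termination
  \<comment> \<open>Unseen vertices count twice, so that moving one into an empty queue lowers the
    measure.\<close>
  by (relation "Wellfounded.measure (\<lambda>(w, q, r). q + 2 * r)") auto

declare forest_weight.simps [simp del]

lemma forest_weight_nonneg: "w \<ge> 0 \<Longrightarrow> forest_weight w q r \<ge> 0"
  by (induction w q r rule: forest_weight.induct) (auto simp: forest_weight.simps intro!: sum_nonneg)

lemma sum_le_exp:
  fixes y :: real
  assumes "0 \<le> y"
  shows "(\<Sum>d\<le>n. y ^ d / fact d) \<le> exp y"
proof -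
  have "(\<Sum>d\<le>n. y ^ d /\<^sub>R fact d) \<le> exp y"
    unfolding exp_def using assms by (intro sum_le_suminf summable_exp_generic) auto
  then show ?thesis by (simp add: field_simps)
qed

text \<open>The exponential generating function in \<open>r\<close> is \<open>exp (q T + (T - T\<^sup>2 / 2) / w)\<close> at \<open>x\<close>, where
  \<open>T = w x exp T\<close> is the rooted tree function. The parametrization \<open>x = y exp (- y) / w\<close>
  makes \<open>T = y\<close>.\<close>

lemma forest_weight_egf_le:
  assumes "w > 0" "0 \<le> y" "y \<le> 1"
  shows "(\<Sum>r\<le>R. forest_weight w q r * (y * exp (- y) / w) ^ r / fact r)
           \<le> exp (real q * y + (y - y\<^sup>2 / 2) / w)"
  using assms(2,3)
\<comment> \<open>\<open>y\<close> is generalized because the case of an empty queue compares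
  derivatives on the whole interval from 0 to \<open>y\<close>.\<close>
proof (induction "q + 2 * R" arbitrary: q R y rule: less_induct)
  case less
  let ?x = "\<lambda>y. y * exp (- y) / w"
  let ?D = "\<lambda>y. exp ((y - y\<^sup>2 / 2) / w)"
  show ?case
  proof (cases q)
    case (Suc p)
    have "(\<Sum>r\<le>R. forest_weight w q r * ?x y ^ r / fact r)
        = (\<Sum>r\<le>R. \<Sum>d\<le>r. (w * ?x y) ^ d / fact d
              * (forest_weight w (p + d) (r - d) * ?x y ^ (r - d) / fact (r - d)))"
    proof (intro sum.cong refl)
      fix r
      show "forest_weight w q r * ?x y ^ r / fact r = (\<Sum>d\<le>r. (w * ?x y) ^ d / fact d
              * (forest_weight w (p + d) (r - d) * ?x y ^ (r - d) / fact (r - d)))"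
        unfolding Suc forest_weight.simps sum_distrib_right sum_divide_distrib
      proof (intro sum.cong refl)
        fix d assume "d \<in> {..r}"
        then have d: "d \<le> r" by simp
        have "?x y ^ r = ?x y ^ d * ?x y ^ (r - d)" using d by (simp flip: power_add)
        then show "real (r choose d) * w ^ d * forest_weight w (p + d) (r - d) * ?x y ^ r / fact r
          = (w * ?x y) ^ d / fact d
              * (forest_weight w (p + d) (r - d) * ?x y ^ (r - d) / fact (r - d))"
          unfolding binomial_fact[OF d, where 'a = real] by (simp only: power_mult_distrib) (simp add: field_simps)
      qed
    qed
    also have "\<dots> = (\<Sum>d\<le>R. \<Sum>r\<le>R - d. (w * ?x y) ^ d / fact d
              * (forest_weight w (p + d) r * ?x y ^ r / fact r))"
      unfolding sum.Sigma[OF finite_atMost ballI[OF finite_atMost]]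
      by (rule sum.reindex_bij_witness[of _ "\<lambda>(d, r). (r + d, d)" "\<lambda>(r, d). (d, r - d)"]) auto
    also have "\<dots> = (\<Sum>d\<le>R. (w * ?x y) ^ d / fact d
              * (\<Sum>r\<le>R - d. forest_weight w (p + d) r * ?x y ^ r / fact r))"
      by (simp add: sum_distrib_left)
    also have "\<dots> \<le> (\<Sum>d\<le>R. (w * ?x y) ^ d / fact d * exp (real (p + d) * y + (y - y\<^sup>2 / 2) / w))"
    proof (intro sum_mono mult_left_mono)
      fix d assume "d \<in> {..R}"
      then show "(\<Sum>r\<le>R - d. forest_weight w (p + d) r * ?x y ^ r / fact r)
            \<le> exp (real (p + d) * y + (y - y\<^sup>2 / 2) / w)"
        using less.prems Suc by (intro less.hyps) auto
    qed (use assms(1) less.prems in auto)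
    \<comment> \<open>Since \<open>w * ?x y = y * exp (- y)\<close>, the factor
      \<open>exp (- y)\<close> of each child cancels the \<open>exp y\<close> of its new queue
      entry. The remaining sum is at most \<open>exp y\<close>, the share of the processed
      vertex.\<close>
    also have "\<dots> = (\<Sum>d\<le>R. y ^ d / fact d) * exp (real p * y + (y - y\<^sup>2 / 2) / w)"
      unfolding sum_distrib_right
    proof (intro sum.cong refl)
      fix d
      have "w * ?x y = y * exp (- y)" using assms(1) by simp
      then have "(w * ?x y) ^ d = y ^ d * exp (- (real d * y))"
        by (simp add: power_mult_distrib flip: exp_of_nat_mult)
      then show "(w * ?x y) ^ d / fact d * exp (real (p + d) * y + (y - y\<^sup>2 / 2) / w)
        = y ^ d / fact d * exp (real p * y + (y - y\<^sup>2 / 2) / w)"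
        by (simp add: exp_add exp_minus algebra_simps)
    qed
    also have "(\<Sum>d\<le>R. y ^ d / fact d) \<le> exp y"
      by (rule sum_le_exp) (use less.prems in auto)
    then have "(\<Sum>d\<le>R. y ^ d / fact d) * exp (real p * y + (y - y\<^sup>2 / 2) / w)
        \<le> exp y * exp (real p * y + (y - y\<^sup>2 / 2) / w)"
      by (intro mult_right_mono) auto
    also have "\<dots> = exp (real q * y + (y - y\<^sup>2 / 2) / w)"
      by (simp add: Suc algebra_simps flip: exp_add)
    finally show ?thesis .
  next
    case 0
    show ?thesis
    proof (cases R)
      case 0
      have "y * y \<le> 1 * y" using less.prems by (intro mult_right_mono) auto
      then have "0 \<le> (y - y\<^sup>2 / 2) / w" using less.prems assms(1) by (simp add: power2_eq_square)
      then show ?thesis using \<open>q = 0\<close> 0 by (simp add: forest_weight.simps)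
    next
      case (Suc R')
      \<comment> \<open>\<open>h\<close> is the partial sum for the empty queue; its derivative with
        respect to \<open>?x\<close> is \<open>h'\<close>, the partial sum for one queued vertex.
        The induction hypothesis for \<open>h'\<close> and the chain rule show that
        \<open>?D\<close> grows at least as fast as \<open>h\<close>, where
        \<open>1 - t \<ge> 0\<close> enters. Both start at 1.\<close>
      define h where "h y = (\<Sum>r\<le>R. forest_weight w 0 r * ?x y ^ r / fact r)" for y
      define h' where "h' y = (\<Sum>r\<le>R'. forest_weight w 1 r * ?x y ^ r / fact r)" for y
      have "h = (\<lambda>y. 1 + (\<Sum>r\<le>R'. forest_weight w 1 r * ?x y ^ Suc r / fact (Suc r)))"
        unfolding h_def Suc by (subst sum.atMost_Suc_shift) (simp add: forest_weight.simps del: fact_Suc)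
      moreover have "((\<lambda>y. 1 + (\<Sum>r\<le>R'. forest_weight w 1 r * ?x y ^ Suc r / fact (Suc r)))
          has_real_derivative h' t * ((1 - t) * exp (- t) / w)) (at t)" for t
      proof -
        have "((\<lambda>y. ?x y) has_real_derivative (1 - t) * exp (- t) / w) (at t)"
          using assms(1) by (auto intro!: derivative_eq_intros simp: field_simps)
        then have "((\<lambda>y. forest_weight w 1 r * ?x y ^ Suc r / fact (Suc r)) has_real_derivative
           forest_weight w 1 r * ?x t ^ r / fact r * ((1 - t) * exp (- t) / w)) (at t)" for r
        proof (rule DERIV_cong[OF DERIV_cdivide[OF DERIV_cmult[OF DERIV_power]]])
          have cancel: "a * (s * (D * X)) / (s * f) = a * X / f * D" if "s \<noteq> 0" for a s D X f :: real
            using that by simp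
          show "forest_weight w 1 r * (real (Suc r) * ((1 - t) * exp (- t) / w * ?x t ^ (Suc r - Suc 0)))
              / fact (Suc r) = forest_weight w 1 r * ?x t ^ r / fact r * ((1 - t) * exp (- t) / w)"
            unfolding fact_Suc diff_Suc_Suc diff_zero of_nat_mult of_nat_fact by (intro cancel) simp
        qed
        then have "((\<lambda>y. \<Sum>r\<le>R'. forest_weight w 1 r * ?x y ^ Suc r / fact (Suc r)) has_real_derivative
           h' t * ((1 - t) * exp (- t) / w)) (at t)"
          unfolding h'_def sum_distrib_right by (intro DERIV_sum)
        from DERIV_add[OF DERIV_const this] show ?thesis by (simp only: add_0)
      qed
      ultimately have dh: "(h has_real_derivative h' t * ((1 - t) * exp (- t) / w)) (at t)" for t
        by simp
      have dD: "(?D has_real_derivative ?D t * ((1 - t) / w)) (at t)" for t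
        using assms(1) by (auto intro!: derivative_eq_intros simp: field_simps)
      have "?D 0 - h 0 \<le> ?D y - h y"
      proof (rule DERIV_nonneg_imp_nondecreasing[OF less.prems(1)])
        fix t assume t: "0 \<le> t" "t \<le> y"
        have "h' t \<le> exp (real 1 * t + (t - t\<^sup>2 / 2) / w)"
          unfolding h'_def using t less.prems \<open>q = 0\<close> Suc by (intro less.hyps) auto
        then have "h' t * exp (- t) \<le> exp (t + (t - t\<^sup>2 / 2) / w) * exp (- t)"
          by (intro mult_right_mono) auto
        also have "\<dots> = ?D t" by (simp flip: exp_add)
        finally have "h' t * exp (- t) * ((1 - t) / w) \<le> ?D t * ((1 - t) / w)"
          using assms(1) t less.prems by (intro mult_right_mono) auto
        then have "0 \<le> ?D t * ((1 - t) / w) - h' t * ((1 - t) * exp (- t) / w)"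
          by (simp add: mult_ac)
        then show "\<exists>z. ((\<lambda>y. ?D y - h y) has_real_derivative z) (at t) \<and> 0 \<le> z"
          using DERIV_diff[OF dD dh] by blast
      qed
      moreover have "h 0 = 1" by (simp add: h_def forest_weight.simps sum.atMost_shift)
      ultimately show ?thesis by (simp add: h_def \<open>q = 0\<close>)
    qed
  qed
qed

text \<open>A single term of the generating function at \<open>y = 1\<close>, the branch point of
  the tree function, where \<open>x = y * exp (- y) / w\<close> is largest.\<close>

corollary forest_weight_le:
  assumes "w > 0"
  shows "forest_weight w 0 n \<le> fact n * (exp 1 * w) ^ n * exp (1 / (2 * w))"
proof -
  let ?a = "\<lambda>r. forest_weight w 0 r * (1 * exp (- 1) / w) ^ r / fact r"
  have "?a n \<le> (\<Sum>r\<le>n. ?a r)"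
    using assms forest_weight_nonneg[of w] by (intro member_le_sum) auto
  also have "\<dots> \<le> exp (1 / (2 * w))"
    using forest_weight_egf_le[OF assms, where y = 1 and R = n and q = 0] by (simp add: power_one_right)
  finally have "forest_weight w 0 n * (exp (- 1) / w) ^ n / fact n \<le> exp (1 / (2 * w))" by simp
  moreover have "(exp (- 1) / w) ^ n = 1 / (exp 1 * w) ^ n"
    by (simp add: exp_minus field_simps power_divide power_mult_distrib)
  moreover have "(exp 1 * w) ^ n > 0" using assms by simp
  ultimately have "forest_weight w 0 n / (fact n * (exp 1 * w) ^ n) \<le> exp (1 / (2 * w))"
    by (simp add: mult_ac)
  then show ?thesis
    using \<open>(exp 1 * w) ^ n > 0\<close> by (subst (asm) pos_divide_le_eq) (simp_all add: mult_ac)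
qed

section \<open>Exploring a graph\<close>

lemma sum_Pow_card:
  fixes f :: "nat \<Rightarrow> real"
  assumes "finite S"
  shows "(\<Sum>T\<in>Pow S. f (card T)) = (\<Sum>d\<le>card S. real (card S choose d) * f d)"
proof -
  have "(\<Sum>T\<in>Pow S. f (card T)) = (\<Sum>d\<in>{..card S}. \<Sum>T\<in>{T\<in>Pow S. card T = d}. f (card T))"
    using assms by (intro sum.group[symmetric]) (auto simp: card_mono)
  also have "\<dots> = (\<Sum>d\<le>card S. real (card S choose d) * f d)"
  proof (intro sum.cong refl)
    fix d
    have "(\<Sum>T\<in>{T\<in>Pow S. card T = d}. f (card T)) = real (card {T. T \<subseteq> S \<and> card T = d}) * f d"
      by (simp add: Pow_def)
    then show "(\<Sum>T\<in>{T\<in>Pow S. card T = d}. f (card T)) = real (card S choose d) * f d"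
      by (simp add: n_subsets[OF assms])
  qed
  finally show ?thesis .
qed

lemma sum_Pow_power_card:
  fixes z :: real
  assumes "finite S"
  shows "(\<Sum>T\<in>Pow S. z ^ card T) = (1 + z) ^ card S"
  using sum_Pow_card[OF assms, of "\<lambda>d. z ^ d"] binomial_ring[of z 1 "card S"]
  by (simp add: add.commute)

section \<open>Splitting a graph into the star at one vertex and the rest\<close>

lemma doubleton_mem_nsets_2: "{v, x} \<in> nsets A 2 \<longleftrightarrow> v \<in> A \<and> x \<in> A \<and> v \<noteq> x"
  by (auto simp: nsets_def card_insert_if)

text \<open>In the exploration \<open>Q\<close> holds the rest of the queue and \<open>R\<close> the
  unseen vertices: edges from \<open>v\<close> into \<open>Q\<close> close cycles, those into
  \<open>R\<close> discover children.\<close>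

lemma star_decomposition:
  assumes "E \<subseteq> nsets (insert v (Q \<union> R)) 2"
  shows "(\<lambda>x. {v, x}) ` ({x\<in>Q. {v, x} \<in> E} \<union> {x\<in>R. {v, x} \<in> E}) \<union> {e\<in>E. v \<notin> e} = E"
    and "{e\<in>E. v \<notin> e} \<subseteq> nsets (Q \<union> R) 2"
proof -
  have "\<exists>x\<in>Q \<union> R. e = {v, x}" if "e \<in> E" "v \<in> e" for e
  proof -
    have "e \<in> nsets (insert v (Q \<union> R)) 2" using that(1) assms by auto
    then have e: "e \<subseteq> insert v (Q \<union> R)" "card e = 2" by (auto simp: nsets_def)
    then obtain x y where xy: "e = {x, y}" "x \<noteq> y" unfolding card_2_iff by blast
    show ?thesis
    proof (cases "x = v")
      case True
      then show ?thesis using xy e(1) by (intro bexI[of _ y]) auto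
    next
      case False
      then have "y = v" using xy that(2) by auto
      then show ?thesis using xy e(1) by (intro bexI[of _ x]) auto
    qed
  qed
  then show "(\<lambda>x. {v, x}) ` ({x\<in>Q. {v, x} \<in> E} \<union> {x\<in>R. {v, x} \<in> E}) \<union> {e\<in>E. v \<notin> e} = E"
    by blast
  show "{e\<in>E. v \<notin> e} \<subseteq> nsets (Q \<union> R) 2"
    using assms by (auto simp: nsets_def)
qed

lemma star_recomposition:
  assumes "Q \<inter> R = {}" "v \<notin> Q \<union> R" "J \<subseteq> Q" "D \<subseteq> R" "E \<subseteq> nsets (Q \<union> R) 2"
  shows "{x\<in>Q. {v, x} \<in> (\<lambda>x. {v, x}) ` (J \<union> D) \<union> E} = J"
    and "{x\<in>R. {v, x} \<in> (\<lambda>x. {v, x}) ` (J \<union> D) \<union> E} = D"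
    and "{e \<in> (\<lambda>x. {v, x}) ` (J \<union> D) \<union> E. v \<notin> e} = E"
proof -
  have vE: "v \<notin> e" if "e \<in> E" for e
    using that assms(2,5) by (auto simp: nsets_def)
  have "{v, x} \<in> (\<lambda>x. {v, x}) ` (J \<union> D) \<longleftrightarrow> x \<in> J \<union> D" for x
    by (auto simp: doubleton_eq_iff)
  then have mem: "{v, x} \<in> (\<lambda>x. {v, x}) ` (J \<union> D) \<union> E \<longleftrightarrow> x \<in> J \<union> D" for x
    using vE[of "{v, x}"] by blast
  show "{x\<in>Q. {v, x} \<in> (\<lambda>x. {v, x}) ` (J \<union> D) \<union> E} = J"
    "{x\<in>R. {v, x} \<in> (\<lambda>x. {v, x}) ` (J \<union> D) \<union> E} = D"
    unfolding mem using assms by blast+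
  show "{e \<in> (\<lambda>x. {v, x}) ` (J \<union> D) \<union> E. v \<notin> e} = E"
    using vE by blast
qed

text \<open>Splitting and regluing at \<open>v\<close> are mutually inverse, so the cycle edges, the
  children and the rest of the graph are chosen independently.\<close>

lemma sum_Pow_nsets_insert:
  fixes g :: "'a set set \<Rightarrow> real"
  assumes "Q \<inter> R = {}" "v \<notin> Q \<union> R"
  shows "(\<Sum>E\<in>Pow (nsets (insert v (Q \<union> R)) 2). g E) =
    (\<Sum>J\<in>Pow Q. \<Sum>D\<in>Pow R. \<Sum>E\<in>Pow (nsets (Q \<union> R) 2). g ((\<lambda>x. {v, x}) ` (J \<union> D) \<union> E))"
proof -
  let ?i = "\<lambda>(J, D, E). (\<lambda>x. {v, x}) ` (J \<union> D) \<union> E"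
  let ?j = "\<lambda>E. ({x\<in>Q. {v, x} \<in> E}, {x\<in>R. {v, x} \<in> E}, {e\<in>E. v \<notin> e})"
  have sub: "nsets (Q \<union> R) 2 \<subseteq> nsets (insert v (Q \<union> R)) 2" by (auto intro!: nsets_mono)
  have "(\<Sum>E\<in>Pow (nsets (insert v (Q \<union> R)) 2). g E) =
      (\<Sum>(J, D, E)\<in>Pow Q \<times> Pow R \<times> Pow (nsets (Q \<union> R) 2). g ((\<lambda>x. {v, x}) ` (J \<union> D) \<union> E))"
  proof (rule sum.reindex_bij_witness[of _ ?i ?j])
    fix E assume "E \<in> Pow (nsets (insert v (Q \<union> R)) 2)"
    then have E: "E \<subseteq> nsets (insert v (Q \<union> R)) 2" by simp
    show eq: "?i (?j E) = E" using star_decomposition(1)[OF E] by simp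
    show "?j E \<in> Pow Q \<times> Pow R \<times> Pow (nsets (Q \<union> R) 2)"
      using star_decomposition(2)[OF E] by simp
    show "(case ?j E of (J, D, E) \<Rightarrow> g ((\<lambda>x. {v, x}) ` (J \<union> D) \<union> E)) = g E"
      using eq by simp
  next
    fix a assume "a \<in> Pow Q \<times> Pow R \<times> Pow (nsets (Q \<union> R) 2)"
    then obtain J D E where a: "a = (J, D, E)" "J \<subseteq> Q" "D \<subseteq> R" "E \<subseteq> nsets (Q \<union> R) 2" by auto
    show "?j (?i a) = a" unfolding a(1) prod.case star_recomposition[OF assms a(2-4)] ..
    show "?i a \<in> Pow (nsets (insert v (Q \<union> R)) 2)"
      using a assms sub by (auto simp: doubleton_mem_nsets_2)
  qed
  then show ?thesis by (simp add: sum.cartesian_product)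
qed

text \<open>\<open>S\<close> collects the components with at least \<open>K\<close> vertices; the loss of one per component is
  spread over its vertices. In the first disjunct the component being explored, of which \<open>k\<close> vertices
  were seen, belongs to \<open>S\<close>; in the second one it stays small.\<close>

definition excess_certificate ::
    "nat \<Rightarrow> 'a set \<Rightarrow> 'a set \<Rightarrow> nat \<Rightarrow> 'a set set \<Rightarrow> nat \<Rightarrow> bool" where
  "excess_certificate K Q R k E x \<longleftrightarrow>
     (\<exists>S. Q \<subseteq> S \<and> S \<subseteq> Q \<union> R \<and>
        K * (card (S \<inter> R) + x + 1) \<le> K * card {e\<in>E. e \<subseteq> S} + card (S \<inter> R) + k) \<or>
     (k < K \<and> (\<exists>S\<subseteq>R. K * (card S + x) \<le> K * card {e\<in>E. e \<subseteq> S} + card S))"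

lemma card_star_Un:
  assumes "finite J" "finite D" "finite E" "J \<inter> D = {}" "\<And>e. e \<in> E \<Longrightarrow> v \<notin> e"
  shows "card ((\<lambda>x. {v, x}) ` (J \<union> D) \<union> E) = card J + card D + card E"
proof -
  have "inj_on (\<lambda>x. {v, x}) (J \<union> D)" by (auto simp: inj_on_def doubleton_eq_iff)
  then have "card ((\<lambda>x. {v, x}) ` (J \<union> D)) = card J + card D"
    using assms by (simp add: card_image card_Un_disjoint)
  then show ?thesis using assms by (subst card_Un_disjoint) auto
qed

text \<open>If \<open>S\<close> includes the queue, adding \<open>v\<close> gains the whole star:
  the edges to \<open>D\<close> pay for the vertices of \<open>D\<close>, which now count as unseen
  instead of in \<open>k\<close>, and the edges to \<open>J\<close> pay for the larger tally. If
  \<open>S\<close> leaves the component out, then \<open>k < K\<close> and the tally stays the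
  same.\<close>

lemma excess_certificate_step:
  assumes fin: "finite Q" "finite R" and disj: "Q \<inter> R = {}" and v: "v \<notin> Q \<union> R"
    and E: "E \<subseteq> nsets (Q \<union> R) 2" and JD: "J \<subseteq> Q" "D \<subseteq> R"
    and cert: "excess_certificate K (Q \<union> D) (R - D) (k + card D) E x"
  shows "excess_certificate K (insert v Q) R k ((\<lambda>x. {v, x}) ` (J \<union> D) \<union> E)
           (x + (if K \<le> k then card J else 0))"
proof -
  let ?E = "(\<lambda>x. {v, x}) ` (J \<union> D) \<union> E"
  have vE: "v \<notin> e" if "e \<in> E" for e using that E v by (auto simp: nsets_def)
  have finE: "finite E" using E fin by (meson finite_UnI finite_imp_finite_nsets finite_subset)
  from cert consider
    (incl) S where "Q \<union> D \<subseteq> S" "S \<subseteq> (Q \<union> D) \<union> (R - D)"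
      "K * (card (S \<inter> (R - D)) + x + 1) \<le>
         K * card {e\<in>E. e \<subseteq> S} + card (S \<inter> (R - D)) + (k + card D)"
  | (excl) S where "k + card D < K" "S \<subseteq> R - D"
      "K * (card S + x) \<le> K * card {e\<in>E. e \<subseteq> S} + card S"
    unfolding excess_certificate_def by blast
  then show ?thesis
  proof cases
    case incl
    have "{e\<in>?E. e \<subseteq> insert v S} = (\<lambda>x. {v, x}) ` (J \<union> D) \<union> {e\<in>E. e \<subseteq> S}"
      using incl(1) JD vE by auto
    then have c1: "card {e\<in>?E. e \<subseteq> insert v S} = card J + card D + card {e\<in>E. e \<subseteq> S}"
      using JD fin disj finE vE by (simp only:) (intro card_star_Un, auto intro: finite_subset)
    have "insert v S \<inter> R = (S \<inter> (R - D)) \<union> D" using incl v JD by auto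
    then have c2: "card (insert v S \<inter> R) = card (S \<inter> (R - D)) + card D"
      using fin JD by (subst card_Un_disjoint[symmetric]) (auto simp: finite_subset)
    have "K * (if K \<le> k then card J else 0) \<le> K * card J" by simp
    then have "K * (card (insert v S \<inter> R) + (x + (if K \<le> k then card J else 0)) + 1) \<le>
         K * card {e\<in>?E. e \<subseteq> insert v S} + card (insert v S \<inter> R) + k"
      unfolding c1 c2 using incl(3) by (simp add: algebra_simps)
    then show ?thesis
      unfolding excess_certificate_def using incl JD by (intro disjI1 exI[of _ "insert v S"]) auto
  next
    case excl
    have "{e\<in>?E. e \<subseteq> S} = {e\<in>E. e \<subseteq> S}" using excl v by auto
    then show ?thesis
      unfolding excess_certificate_def using excl by (intro disjI2 conjI exI[of _ S]) auto
  qed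
qed

text \<open>When the queue includes only the root \<open>v\<close> and \<open>S\<close> contains it,
  the summand 1 on either side is \<open>v\<close> itself as a vertex of \<open>S\<close>. The
  finished component falls under the second disjunct for \<open>k < K\<close>; otherwise its
  \<open>k \<ge> K\<close> vertices pay for the loss of one in the first.\<close>

lemma excess_certificate_new_root:
  assumes "finite R" "v \<notin> R" "excess_certificate K {v} R 1 E x"
  shows "excess_certificate K {} (insert v R) k E x"
proof -
  obtain S where S: "S \<subseteq> insert v R" "K * (card S + x) \<le> K * card {e\<in>E. e \<subseteq> S} + card S"
  proof -
    from assms(3) consider
      (incl) S where "{v} \<subseteq> S" "S \<subseteq> {v} \<union> R"
        "K * (card (S \<inter> R) + x + 1) \<le> K * card {e\<in>E. e \<subseteq> S} + card (S \<inter> R) + 1"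
    | (excl) S where "S \<subseteq> R" "K * (card S + x) \<le> K * card {e\<in>E. e \<subseteq> S} + card S"
      unfolding excess_certificate_def by blast
    then show ?thesis
    proof cases
      case incl
      have "S = insert v (S \<inter> R)" using incl by auto
      then have "card S = card (S \<inter> R) + 1"
        using assms by (metis Int_iff Suc_eq_plus1 card_insert_disjoint finite_Int)
      then show ?thesis using incl that[of S] by (auto simp: algebra_simps)
    qed (use that in blast)
  qed
  have "S \<inter> insert v R = S" using S by auto
  then show ?thesis
    unfolding excess_certificate_def using S
    by (cases "k < K") (auto simp: algebra_simps intro!: exI[of _ S])
qed

text \<open>The exploration invariant: \<open>Q\<close> is the queue and \<open>R\<close> the set of unseen vertices, \<open>k\<close> counts
  the seen vertices of the current component, and only edges inside \<open>Q \<union> R\<close> are still unrevealed.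
  \<open>X E\<close> counts the edges closing a cycle that are revealed once at least \<open>K\<close> vertices of their
  component were seen. The cycle edges in smaller components are not counted; they contribute at most
  a factor \<open>(1 + w) ^ K\<close> per step.\<close>

lemma exploration_bound:
  fixes w \<theta> :: real and Q R :: "'a set"
  assumes w: "w > 0" and \<theta>: "0 < \<theta>" "\<theta> \<le> 1"
  assumes "finite Q" "finite R" "Q \<inter> R = {}" "card Q \<le> k" "card (Q \<union> R) \<le> n"
  shows "\<exists>X. (\<forall>E\<in>Pow (nsets (Q \<union> R) 2). excess_certificate K Q R k E (X E)) \<and>
     (\<Sum>E\<in>Pow (nsets (Q \<union> R) 2). w ^ card E * \<theta> ^ X E)
        \<le> ((1 + w) ^ K * (1 + w * \<theta>) ^ n) ^ card (Q \<union> R) * forest_weight w (card Q) (card R)"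
  using assms(4-)
proof (induction "card Q + 2 * card R" arbitrary: Q R k rule: less_induct)
  case less
  let ?L = "(1 + w) ^ K * (1 + w * \<theta>) ^ n"
  have ge1: "1 \<le> (1 + w) ^ K" "1 \<le> (1 + w * \<theta>) ^ n"
    using w \<theta> by (auto intro!: one_le_power)
  consider "Q = {}" "R = {}" | v where "Q = {}" "v \<in> R" | v where "v \<in> Q" by blast
  then show ?case
  proof cases
    case 1
    \<comment> \<open>\<open>S = {}\<close> serves: in the second disjunct for \<open>k < K\<close>,
      else in the first, where \<open>k\<close> covers \<open>K\<close>.\<close>
    have "excess_certificate K {} {} k {} 0"
      unfolding excess_certificate_def by (cases "k < K") auto
    then show ?thesis using 1
      by (intro exI[of _ "\<lambda>_. 0"]) (simp add: nsets_empty_iff forest_weight.simps)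
  next
    case (2 v)
    define R' where "R' = R - {v}"
    have R: "R = insert v R'" "v \<notin> R'" "finite R'" using 2 less.prems by (auto simp: R'_def)
    obtain X where X:
      "\<forall>E\<in>Pow (nsets ({v} \<union> R') 2). excess_certificate K {v} R' 1 E (X E)"
      "(\<Sum>E\<in>Pow (nsets ({v} \<union> R') 2). w ^ card E * \<theta> ^ X E)
         \<le> ?L ^ card ({v} \<union> R') * forest_weight w (card {v}) (card R')"
      using less.hyps[of "{v}" R' 1] R less.prems 2 by auto
    show ?thesis
    proof (intro exI[of _ X] conjI ballI)
      fix E assume "E \<in> Pow (nsets (Q \<union> R) 2)"
      then have "excess_certificate K {v} R' 1 E (X E)" using X(1) 2 R by simp
      then show "excess_certificate K Q R k E (X E)"
        using excess_certificate_new_root[OF R(3,2)] 2 R by simp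
    next
      have "forest_weight w (card Q) (card R) = forest_weight w (card {v}) (card R')"
        using R 2 by (simp add: forest_weight.simps)
      then show "(\<Sum>E\<in>Pow (nsets (Q \<union> R) 2). w ^ card E * \<theta> ^ X E)
          \<le> ?L ^ card (Q \<union> R) * forest_weight w (card Q) (card R)"
        using X(2) \<open>Q = {}\<close> by (simp add: R(1))
    qed
  next
    case (3 v)
    define Q' where "Q' = Q - {v}"
    have Q: "Q = insert v Q'" "v \<notin> Q'" "finite Q'" "card Q = Suc (card Q')"
      using 3 less.prems(1) card.remove[OF less.prems(1) 3] unfolding Q'_def by blast+
    have disj: "Q' \<inter> R = {}" "v \<notin> Q' \<union> R" and finR: "finite R"
      using less.prems(2,3) Q(1,2) by blast+
    have card: "card (Q \<union> R) = Suc (card (Q' \<union> R))" using Q disj finR by simp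
    let ?V = "nsets (Q' \<union> R) 2"
    have V: "(Q' \<union> D) \<union> (R - D) = Q' \<union> R" if "D \<subseteq> R" for D using that by auto
    have cD: "card (Q' \<union> D) = card Q' + card D" "card (R - D) = card R - card D"
        "card D \<le> card R" "finite D" if "D \<subseteq> R" for D
    proof -
      show "finite D" using that finR finite_subset by blast
      then show "card (Q' \<union> D) = card Q' + card D"
        using that disj Q by (intro card_Un_disjoint) auto
      show "card (R - D) = card R - card D" "card D \<le> card R"
        using that finR \<open>finite D\<close> by (auto simp: card_Diff_subset card_mono)
    qed
    \<comment> \<open>The induction hypothesis is applied to each set \<open>D\<close> of children
      separately, so the tally depends on \<open>D\<close> as well.\<close>
    have "\<forall>D\<in>Pow R. \<exists>X. (\<forall>E\<in>Pow ?V. excess_certificate K (Q' \<union> D) (R - D) (k + card D) E (X E)) \<and>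
       (\<Sum>E\<in>Pow ?V. w ^ card E * \<theta> ^ X E)
        \<le> ?L ^ card (Q' \<union> R) * forest_weight w (card Q' + card D) (card R - card D)"
    proof
      fix D assume "D \<in> Pow R"
      then have D: "D \<subseteq> R" by simp
      show "\<exists>X. (\<forall>E\<in>Pow ?V. excess_certificate K (Q' \<union> D) (R - D) (k + card D) E (X E)) \<and>
       (\<Sum>E\<in>Pow ?V. w ^ card E * \<theta> ^ X E)
        \<le> ?L ^ card (Q' \<union> R) * forest_weight w (card Q' + card D) (card R - card D)"
        unfolding V[OF D, symmetric] cD(1,2)[OF D, symmetric]
      proof (rule less.hyps)
        show "card (Q' \<union> D) + 2 * card (R - D) < card Q + 2 * card R"
          using cD[OF D] Q(4) by linarith
        show "finite (Q' \<union> D)" "finite (R - D)" "(Q' \<union> D) \<inter> (R - D) = {}"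
          using Q(3) cD(4)[OF D] finR disj by auto
        show "card (Q' \<union> D) \<le> k + card D" "card (Q' \<union> D \<union> (R - D)) \<le> n"
          using cD[OF D] Q(4) less.prems card V[OF D] by simp_all
      qed
    qed
    from bchoice[OF this] obtain X where X0: "\<forall>D\<in>Pow R.
       (\<forall>E\<in>Pow ?V. excess_certificate K (Q' \<union> D) (R - D) (k + card D) E (X D E)) \<and>
       (\<Sum>E\<in>Pow ?V. w ^ card E * \<theta> ^ X D E)
        \<le> ?L ^ card (Q' \<union> R) * forest_weight w (card Q' + card D) (card R - card D)" ..
    have X: "excess_certificate K (Q' \<union> D) (R - D) (k + card D) E (X D E)"
        if "D \<subseteq> R" "E \<subseteq> ?V" for D E
      using X0 that by blast
    have X_sum: "(\<Sum>E\<in>Pow ?V. w ^ card E * \<theta> ^ X D E)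
        \<le> ?L ^ card (Q' \<union> R) * forest_weight w (card Q' + card D) (card R - card D)"
      if "D \<subseteq> R" for D
      using X0 that by blast
    define J where "J E = {x\<in>Q'. {v, x} \<in> E}" for E
    define D where "D E = {x\<in>R. {v, x} \<in> E}" for E
    define E' where "E' E = {e\<in>E. v \<notin> e}" for E :: "'a set set"
    define Y where "Y E = X (D E) (E' E) + (if K \<le> k then card (J E) else 0)" for E
    let ?G = "\<lambda>J D E. (\<lambda>x. {v, x}) ` (J \<union> D) \<union> E"
    have VE: "v \<notin> e" if "e \<in> ?V" for e using that disj(2) by (auto simp: nsets_def)
    have finV: "finite ?V" using Q finR by (simp add: finite_imp_finite_nsets)
    have split: "?G (J E) (D E) (E' E) = E" "E' E \<subseteq> ?V" if "E \<subseteq> nsets (Q \<union> R) 2" for E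
      using star_decomposition[of E v Q' R] that Q(1) unfolding J_def D_def E'_def by simp_all
    have cert: "excess_certificate K Q R k E (Y E)" if "E \<in> Pow (nsets (Q \<union> R) 2)" for E
    proof -
      have "excess_certificate K (insert v Q') R k (?G (J E) (D E) (E' E)) (Y E)"
        unfolding Y_def using that Q disj finR split[of E]
        by (intro excess_certificate_step X) (auto simp: J_def D_def)
      then show ?thesis using split[of E] that Q by simp
    qed
    \<comment> \<open>The discount for a cycle edge at \<open>v\<close>, granted only once
      \<open>K\<close> vertices of the component were seen.\<close>
    define \<alpha> where "\<alpha> = (if K \<le> k then \<theta> else 1)"
    have summand: "w ^ card (?G A B F) * \<theta> ^ Y (?G A B F)
        = (w * \<alpha>) ^ card A * (w ^ card B * (w ^ card F * \<theta> ^ X B F))"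
      if "A \<subseteq> Q'" "B \<subseteq> R" "F \<subseteq> ?V" for A B F
    proof -
      have JDE: "J (?G A B F) = A" "D (?G A B F) = B" "E' (?G A B F) = F"
        unfolding J_def D_def E'_def by (rule star_recomposition[OF disj that])+
      have "card (?G A B F) = card A + card B + card F"
        using that VE disj finV finR Q by (intro card_star_Un) (auto intro: finite_subset)
      then show ?thesis
        unfolding Y_def JDE \<alpha>_def by (simp add: power_add power_mult_distrib)
    qed
    have "(\<Sum>E\<in>Pow (nsets (Q \<union> R) 2). w ^ card E * \<theta> ^ Y E)
        = (\<Sum>A\<in>Pow Q'. \<Sum>B\<in>Pow R. \<Sum>F\<in>Pow ?V.
             (w * \<alpha>) ^ card A * (w ^ card B * (w ^ card F * \<theta> ^ X B F)))"
      unfolding Q(1) Un_insert_left sum_Pow_nsets_insert[OF disj]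
      by (intro sum.cong refl summand) auto
    also have "\<dots> = (1 + w * \<alpha>) ^ card Q' *
        (\<Sum>B\<in>Pow R. w ^ card B * (\<Sum>F\<in>Pow ?V. w ^ card F * \<theta> ^ X B F))"
      by (simp only: sum_distrib_left[symmetric] sum_distrib_right[symmetric]
            sum_Pow_power_card[OF Q(3)])
    also have "\<dots> \<le> (1 + w * \<alpha>) ^ card Q' *
        (\<Sum>B\<in>Pow R. w ^ card B *
          (?L ^ card (Q' \<union> R) * forest_weight w (card Q' + card B) (card R - card B)))"
      using w \<theta> X_sum by (intro mult_left_mono sum_mono) (auto simp: \<alpha>_def)
    \<comment> \<open>Grouped by the size of the set of children, the sum is the recursion of
      \<open>forest_weight\<close> for a nonempty queue.\<close>
    also have "\<dots> = (1 + w * \<alpha>) ^ card Q' * (?L ^ card (Q' \<union> R) * forest_weight w (card Q) (card R))"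
      unfolding Q(4) forest_weight.simps
      by (subst sum_Pow_card[OF finR]) (simp add: sum_distrib_left mult_ac)
    \<comment> \<open>Each processed vertex costs one factor \<open>?L\<close>: in a large component
      it has at most \<open>n\<close> possible cycle edges, all discounted; in a small one fewer
      than \<open>K\<close>, since the queue has at most \<open>k < K\<close> vertices.\<close>
    also have "\<dots> \<le> ?L * (?L ^ card (Q' \<union> R) * forest_weight w (card Q) (card R))"
    proof (rule mult_right_mono)
      have "card Q \<le> card (Q \<union> R)" using less.prems by (intro card_mono) auto
      then have n: "card Q' \<le> n" using Q(4) less.prems by linarith
      show "(1 + w * \<alpha>) ^ card Q' \<le> ?L"
      proof (cases "K \<le> k")
        case True
        then have "(1 + w * \<alpha>) ^ card Q' \<le> (1 + w * \<theta>) ^ n"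
          using w \<theta> n by (auto simp: \<alpha>_def intro!: power_increasing)
        also have "\<dots> \<le> ?L" using mult_right_mono[of 1 "(1 + w) ^ K" "(1 + w * \<theta>) ^ n"] ge1 by simp
        finally show ?thesis .
      next
        case False
        then have "(1 + w * \<alpha>) ^ card Q' \<le> (1 + w) ^ K"
          using w Q(4) less.prems by (auto simp: \<alpha>_def intro!: power_increasing)
        also have "\<dots> \<le> ?L" using mult_left_mono[of 1 "(1 + w * \<theta>) ^ n" "(1 + w) ^ K"] ge1 by simp
        finally show ?thesis .
      qed
      show "0 \<le> ?L ^ card (Q' \<union> R) * forest_weight w (card Q) (card R)"
        using w \<theta> by (intro mult_nonneg_nonneg forest_weight_nonneg) auto
    qed
    also have "\<dots> = ?L ^ card (Q \<union> R) * forest_weight w (card Q) (card R)"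
      by (simp add: card)
    finally show ?thesis
      using cert by blast
  qed
qed

section \<open>Graphs of low excess are rare\<close>

text \<open>The induction step rests on \<open>1 - 1 / (n + 1) \<le> exp (- 1 / (n + 1))\<close>,
  raised to the power \<open>n + 1\<close>.\<close>

lemma fact_le_Stirling:
  assumes "n \<ge> 1"
  shows "fact n \<le> exp 1 * real n * (real n / exp 1) ^ n"
  using assms
proof (induction n rule: nat_induct_at_least)
  case base
  then show ?case by simp
next
  case (Suc n)
  have "real n / (real n + 1) = 1 + - 1 / (real n + 1)" by (simp add: field_simps)
  also have "\<dots> \<le> exp (- 1 / (real n + 1))" by (rule exp_ge_add_one_self)
  finally have "(real n / (real n + 1)) ^ Suc n \<le> exp (- 1 / (real n + 1)) ^ Suc n"
    by (intro power_mono) auto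
  also have "\<dots> = exp (- 1)" unfolding exp_of_nat_mult[symmetric] by (simp add: add.commute)
  finally have "real n ^ Suc n \<le> exp (- 1) * (real n + 1) ^ Suc n"
    by (simp add: power_divide divide_le_eq del: power_Suc)
  then have "real n ^ Suc n / exp 1 ^ n \<le> exp (- 1) * (real n + 1) ^ Suc n / exp 1 ^ n"
    by (intro divide_right_mono) auto
  then have *: "real n * (real n / exp 1) ^ n \<le> (real (Suc n) / exp 1) ^ Suc n"
    by (simp add: power_divide exp_minus field_simps)
  have "fact (Suc n) \<le> real (Suc n) * (exp 1 * real n * (real n / exp 1) ^ n)"
    unfolding fact_Suc using Suc.IH by (intro mult_left_mono) auto
  also have "\<dots> = exp 1 * real (Suc n) * (real n * (real n / exp 1) ^ n)" by simp
  also have "\<dots> \<le> exp 1 * real (Suc n) * (real (Suc n) / exp 1) ^ Suc n"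
    using * by (intro mult_left_mono) auto
  finally show ?case .
qed

lemma power_mult_fact_le_fact_add: "a ^ m * fact a \<le> (fact (a + m) :: nat)"
proof (induction m)
  case (Suc m)
  have "a ^ Suc m * fact a \<le> a * fact (a + m)" using Suc by (simp add: mult.assoc)
  also have "\<dots> \<le> Suc (a + m) * fact (a + m)" by (intro mult_right_mono) auto
  finally show ?case by simp
qed simp

text \<open>\<open>fact m * (M choose m)\<close> is a falling factorial with \<open>m\<close>
  factors, each larger than \<open>M - m\<close>.\<close>

lemma power_le_fact_mult_binomial:
  assumes "m \<le> M"
  shows "(M - m) ^ m \<le> fact m * (M choose m)"
proof -
  have "(M - m) ^ m * fact (M - m) \<le> fact m * (M choose m) * fact (M - m)"
    using power_mult_fact_le_fact_add[of "M - m" m] binomial_fact_lemma[OF assms] assms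
    by (simp add: mult_ac)
  then show ?thesis by simp
qed

text \<open>The expression vanishes at \<open>s = 1\<close>, which corresponds to the threshold
  \<open>lam = 1/2\<close>, and its derivative \<open>- (1 / s - 1)\<^sup>2 / 2\<close> is negative
  beyond.\<close>

lemma ln_add_half_inverse_less:
  assumes "s > 1"
  shows "ln s + 1 / (2 * s) - s / 2 < (0::real)"
proof -
  let ?r = "\<lambda>s::real. ln s + 1 / (2 * s) - s / 2"
  have "?r s < ?r 1"
  proof (rule DERIV_neg_imp_decreasing_open[OF assms])
    fix x :: real assume x: "1 < x" "x < s"
    have "(?r has_real_derivative (1 / x - 1 / (2 * x\<^sup>2) - 1 / 2)) (at x)"
      using x by (auto intro!: derivative_eq_intros simp: field_simps power2_eq_square)
    moreover have "1 / x - 1 / (2 * x\<^sup>2) - 1 / 2 = - ((1 / x - 1)\<^sup>2 / 2)"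
      using x by (simp add: field_simps power2_eq_square)
    moreover have "(1 / x - 1)\<^sup>2 > 0" using x by simp
    ultimately show "\<exists>y. (?r has_real_derivative y) (at x) \<and> y < 0" by force
  qed (auto intro!: continuous_intros)
  then show ?thesis by simp
qed

lemma real_choose_two: "real (n choose 2) = real n * (real n - 1) / 2"
proof (cases n)
  case (Suc k)
  have "even (n * (n - 1))" using Suc by simp
  then have "real (n choose 2) = real (n * (n - 1)) / 2"
    unfolding choose_two using real_of_nat_div[of 2 "n * (n - 1)"] by (metis of_nat_numeral)
  then show ?thesis using Suc by (simp add: algebra_simps)
qed simp

section \<open>First-moment bound on graphs of low excess\<close>

text \<open>A Markov-type estimate from \<open>exploration_bound\<close> with
  \<open>\<theta> = exp (- \<tau>)\<close>: the certificate of a low-excess graph forces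
  \<open>X E < 2 * card V / K\<close>, which bounds its term in the weighted sum from below.\<close>

lemma card_low_excess_graphs_le:
  fixes V :: "'v set" and w \<tau> :: real and K m :: nat
  assumes "finite V" "w > 0" "\<tau> \<ge> 0" "K > 0"
  shows "real (card {E\<in>graphs_with_edges V m.
            \<forall>S\<subseteq>V. real (card {e\<in>E. e \<subseteq> S}) - real (card S) < card V / K})
           * (w ^ m * exp (- (2 * \<tau> * card V / K)))
         \<le> ((1 + w) ^ K * (1 + w * exp (- \<tau>)) ^ card V) ^ card V * forest_weight w 0 (card V)"
proof -
  let ?P = "Pow (nsets V 2)"
  define bad where "bad = {E\<in>graphs_with_edges V m.
            \<forall>S\<subseteq>V. real (card {e\<in>E. e \<subseteq> S}) - real (card S) < card V / K}"
  obtain X where cert: "\<And>E. E \<in> ?P \<Longrightarrow> excess_certificate K {} V 0 E (X E)"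
    and sum: "(\<Sum>E\<in>?P. w ^ card E * exp (- \<tau>) ^ X E)
      \<le> ((1 + w) ^ K * (1 + w * exp (- \<tau>)) ^ card V) ^ card V * forest_weight w 0 (card V)"
    using exploration_bound[of w "exp (- \<tau>)" "{}" V 0 "card V" K] assms by auto
  have finP: "finite ?P" using assms by (simp add: finite_imp_finite_nsets)
  have bad: "E \<in> ?P" "card E = m" "real (X E) < 2 * card V / K" if "E \<in> bad" for E
  proof -
    show E: "E \<in> ?P" "card E = m" using that by (auto simp: bad_def graphs_with_edges_def)
    obtain S where S: "S \<subseteq> V" "K * (card S + X E) \<le> K * card {e\<in>E. e \<subseteq> S} + card S"
    proof -
      from cert[OF E(1)] consider
        (incl) S where "S \<subseteq> V" "K * (card (S \<inter> V) + X E + 1) \<le> K * card {e\<in>E. e \<subseteq> S} + card (S \<inter> V)"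
      | (excl) S where "S \<subseteq> V" "K * (card S + X E) \<le> K * card {e\<in>E. e \<subseteq> S} + card S"
        unfolding excess_certificate_def by auto
      then show ?thesis
      proof cases
        case incl
        have "S \<inter> V = S" using incl by auto
        then show ?thesis using incl that[of S] by (simp add: algebra_simps)
      qed (use that in blast)
    qed
    have "real K * (real (card S) + real (X E)) \<le> real K * real (card {e\<in>E. e \<subseteq> S}) + real (card S)"
      using S(2) by (simp flip: of_nat_add of_nat_mult)
    also have "real (card S) \<le> card V" using S assms by (simp add: card_mono)
    finally have "real (card S) + real (X E) \<le> real (card {e\<in>E. e \<subseteq> S}) + card V / K"
      using assms(4) by (simp add: field_simps)
    moreover have "real (card {e\<in>E. e \<subseteq> S}) - real (card S) < card V / K"
      using that S by (auto simp: bad_def)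
    ultimately show "real (X E) < 2 * card V / K" by simp
  qed
  have "real (card bad) * (w ^ m * exp (- (2 * \<tau> * card V / K)))
      = (\<Sum>E\<in>bad. w ^ m * exp (- (2 * \<tau> * card V / K)))" by simp
  also have "\<dots> \<le> (\<Sum>E\<in>bad. w ^ card E * exp (- \<tau>) ^ X E)"
  proof (intro sum_mono)
    fix E assume E: "E \<in> bad"
    have "\<tau> * real (X E) \<le> \<tau> * (2 * card V / K)"
      using bad(3)[OF E] assms by (intro mult_left_mono) auto
    then have "exp (- (2 * \<tau> * card V / K)) \<le> exp (- \<tau>) ^ X E"
      by (simp add: mult_ac flip: exp_of_nat_mult)
    then show "w ^ m * exp (- (2 * \<tau> * card V / K)) \<le> w ^ card E * exp (- \<tau>) ^ X E"
      using bad(2)[OF E] assms by (simp add: mult_left_mono)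
  qed
  also have "\<dots> \<le> (\<Sum>E\<in>?P. w ^ card E * exp (- \<tau>) ^ X E)"
    using finP bad(1) assms by (intro sum_mono2) auto
  also note sum
  finally show ?thesis unfolding bad_def .
qed

text \<open>The edge weight is \<open>w = u / n\<close>, the odds of the edge density of a graph
  with \<open>m\<close> edges. In the exponent, \<open>2 * \<tau> / K\<close> comes from the tally,
  the next two terms from cycle edges in small and in large components,
  \<open>ln u + 1 / (2 * u)\<close> from the forests, and \<open>- m / n\<close> from the weighted
  number of all graphs.\<close>

lemma low_excess_fraction_le:
  fixes V :: "'v set" and \<tau> u :: real and K m n :: nat
  assumes V: "finite V" "card V = n" "n \<ge> 1" and m: "1 \<le> m" "m < n choose 2"
    and \<tau>: "\<tau> \<ge> 0" and K: "K > 0"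
  defines "u \<equiv> real n * real m / real ((n choose 2) - m)"
  shows "real (card {E\<in>graphs_with_edges V m.
            \<forall>S\<subseteq>V. real (card {e\<in>E. e \<subseteq> S}) - real (card S) < n / K})
          / real ((n choose 2) choose m)
         \<le> exp 2 * real n * real m *
            exp (real n * (2 * \<tau> / K + K * u / n + u * exp (- \<tau>) + ln u + 1 / (2 * u) - m / n))"
proof -
  define M where "M = (n choose 2)"
  define B where "B = real (card {E\<in>graphs_with_edges V m.
            \<forall>S\<subseteq>V. real (card {e\<in>E. e \<subseteq> S}) - real (card S) < n / K})"
  define w where "w = real m / real (M - m)"
  have w: "w > 0" using m by (simp add: w_def M_def)
  have u: "u = n * w" "u > 0" using m V by (simp_all add: u_def w_def M_def)
  let ?C = "real (M choose m)"
  have C: "?C > 0" using m by (simp add: M_def)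
  have "B * (w ^ m * exp (- (2 * \<tau> * n / K)))
      \<le> ((1 + w) ^ K * (1 + w * exp (- \<tau>)) ^ n) ^ n * forest_weight w 0 n"
    using card_low_excess_graphs_le[OF V(1) w \<tau> K, of m] by (simp add: B_def V(2))
  also have "\<dots> \<le> exp (K * u + n * u * exp (- \<tau>)) * (exp 1 * n * exp (n * ln u) * exp (1 / (2 * w)))"
  proof (rule mult_mono)
    have "((1 + w) ^ K * (1 + w * exp (- \<tau>)) ^ n) ^ n \<le> (exp w ^ K * exp (w * exp (- \<tau>)) ^ n) ^ n"
      using w by (intro power_mono mult_mono) (auto intro!: exp_ge_add_one_self)
    also have "\<dots> = exp (K * u + n * u * exp (- \<tau>))"
      by (simp add: u algebra_simps flip: exp_of_nat_mult exp_add)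
    finally show "((1 + w) ^ K * (1 + w * exp (- \<tau>)) ^ n) ^ n \<le> exp (K * u + n * u * exp (- \<tau>))" .
    have "fact n * (exp 1 * w) ^ n \<le> exp 1 * real n * (real n / exp 1) ^ n * (exp 1 * w) ^ n"
      using fact_le_Stirling[OF V(3)] w by (intro mult_right_mono) auto
    also have "\<dots> = exp 1 * n * u ^ n"
      by (simp add: u power_divide power_mult_distrib)
    also have "u ^ n = exp (n * ln u)" using u(2) by (simp add: exp_of_nat_mult)
    finally have "fact n * (exp 1 * w) ^ n * exp (1 / (2 * w)) \<le> exp 1 * n * exp (n * ln u) * exp (1 / (2 * w))"
      by (intro mult_right_mono) auto
    with forest_weight_le[OF w, of n]
    show "forest_weight w 0 n \<le> exp 1 * n * exp (n * ln u) * exp (1 / (2 * w))" by linarith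
  qed (use w forest_weight_nonneg[of w 0 n] in auto)
  finally have 1: "B * (w ^ m * exp (- (2 * \<tau> * n / K)))
     \<le> exp (K * u + n * u * exp (- \<tau>)) * (exp 1 * n * exp (n * ln u) * exp (1 / (2 * w)))" .
  \<comment> \<open>For this \<open>w\<close>, \<open>w ^ m * (M - m) ^ m = m ^ m\<close>; by the
    bound on \<open>fact m\<close>, all graphs with \<open>m\<close> edges together weigh at least
    \<open>exp m / (exp 1 * m)\<close>.\<close>
  have "real ((M - m) ^ m) \<le> real (fact m * (M choose m))"
    using power_le_fact_mult_binomial[of m M] m unfolding M_def of_nat_le_iff by simp
  then have "w ^ m * real (M - m) ^ m \<le> w ^ m * (fact m * ?C)"
    using w by (intro mult_left_mono) auto
  also have "w ^ m * real (M - m) ^ m = real m ^ m"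
    using m by (simp add: w_def M_def flip: power_mult_distrib)
  also have "w ^ m * (fact m * ?C) \<le> w ^ m * (exp 1 * real m * (real m / exp 1) ^ m * ?C)"
    using w C fact_le_Stirling[OF m(1)] by (intro mult_left_mono mult_right_mono) auto
  also have "\<dots> = real m ^ m * (w ^ m * ?C * (exp 1 * m * exp (- real m)))"
    by (simp add: power_divide exp_minus flip: exp_of_nat_mult) (simp add: field_simps)
  finally have 2: "1 \<le> w ^ m * ?C * (exp 1 * m * exp (- real m))"
    using m by simp
  have "B = B * 1" by simp
  also have "\<dots> \<le> B * (w ^ m * ?C * (exp 1 * m * exp (- real m)))"
    using 2 by (intro mult_left_mono) (auto simp: B_def)
  also have "\<dots> = B * (w ^ m * exp (- (2 * \<tau> * n / K)))
       * (exp (2 * \<tau> * n / K) * ?C * (exp 1 * m * exp (- real m)))"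
    by (simp add: exp_minus field_simps)
  also have "\<dots> \<le> exp (K * u + n * u * exp (- \<tau>)) * (exp 1 * n * exp (n * ln u) * exp (1 / (2 * w)))
       * (exp (2 * \<tau> * n / K) * ?C * (exp 1 * m * exp (- real m)))"
    using C by (intro mult_right_mono[OF 1]) auto
  also have "\<dots> = (exp 1 * exp 1) * n * m * (exp (K * u + n * u * exp (- \<tau>)) * exp (n * ln u) * exp (1 / (2 * w))
       * exp (2 * \<tau> * n / K) * exp (- real m)) * ?C"
    by (simp only: mult_ac)
  also have "\<dots> = exp 2 * n * m *
        exp (n * (2 * \<tau> / K + K * u / n + u * exp (- \<tau>) + ln u + 1 / (2 * u) - m / n)) * ?C"
  proof -
    have "K * u + n * u * exp (- \<tau>) + n * ln u + 1 / (2 * w) + 2 * \<tau> * n / K + - real m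
      = n * (2 * \<tau> / K + K * u / n + u * exp (- \<tau>) + ln u + 1 / (2 * u) - m / n)"
      using V(3) w K by (simp add: u field_simps)
    then show ?thesis by (simp flip: exp_add)
  qed
  finally show ?thesis using C by (simp add: B_def M_def divide_le_eq)
qed

section \<open>Choice of the constants and the limit\<close>

text \<open>First \<open>\<tau>\<close> is taken large enough to make counted cycle edges cheap,
  then \<open>K\<close> large in terms of \<open>\<tau>\<close>; with both fixed,
  \<open>K * u n / n\<close> vanishes. The rate at \<open>s = 2 * lam\<close> dominates what is
  left, and exponential decay beats the polynomial factor.\<close>

lemma low_excess_bound_tendsto_0:
  fixes lam :: real and m :: "nat \<Rightarrow> nat" and u :: "nat \<Rightarrow> real"
  assumes "lam > 1/2"
  defines "m \<equiv> \<lambda>n. nat \<lfloor>lam * real n\<rfloor>"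
  defines "u \<equiv> \<lambda>n. real n * real (m n) / real ((n choose 2) - m n)"
  obtains \<tau> :: real and K :: nat where "\<tau> \<ge> 0" "K > 0"
    "(\<lambda>n. exp 2 * real n * real (m n) * exp (real n *
        (2 * \<tau> / K + K * u n / n + u n * exp (- \<tau>) + ln (u n) + 1 / (2 * u n) - m n / n))) \<longlonglongrightarrow> 0"
    "eventually (\<lambda>n. 1 \<le> m n \<and> m n < n choose 2) sequentially"
proof -
  \<comment> \<open>One eighth of the absolute rate: \<open>\<tau>\<close> and \<open>K\<close> cost
    less than \<open>c\<close> each, so the exponent per vertex has a limit below
    \<open>- 6 * c\<close>.\<close>
  define c where "c = - (ln (2 * lam) + 1 / (2 * (2 * lam)) - 2 * lam / 2) / 8"
  have c: "c > 0" using ln_add_half_inverse_less[of "2 * lam"] assms(1) by (simp add: c_def)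
  have "((\<lambda>\<tau>. 2 * lam * exp (- \<tau>)) \<longlongrightarrow> 2 * lam * 0) at_top"
    by (intro tendsto_intros filterlim_compose[OF exp_at_bot] filterlim_uminus_at_bot_at_top)
  then have "eventually (\<lambda>\<tau>. 2 * lam * exp (- \<tau>) < c) at_top"
    by (rule order_tendstoD) (use c in simp)
  then have "eventually (\<lambda>\<tau>. 0 \<le> \<tau> \<and> 2 * lam * exp (- \<tau>) < c) at_top"
    using eventually_ge_at_top[of "0::real"] by eventually_elim auto
  then obtain \<tau> :: real where \<tau>: "0 \<le> \<tau>" "2 * lam * exp (- \<tau>) < c"
    unfolding eventually_at_top_linorder by blast
  obtain K :: nat where K: "2 * \<tau> / c < real K" "K > 0"
    using reals_Archimedean2[of "max 1 (2 * \<tau> / c)"] by auto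
  have Kc: "2 * \<tau> / K < c" using K c by (simp add: field_simps)
  have mb: "lam * real n - 1 \<le> real (m n)" "real (m n) \<le> lam * real n" for n
    using assms(1) by (simp_all add: m_def of_nat_nat)
  have r: "(\<lambda>n. m n / n) \<longlonglongrightarrow> lam"
  proof (rule tendsto_sandwich)
    show "(\<lambda>n. lam - 1 / real n) \<longlonglongrightarrow> lam" by real_asymp
    show "(\<lambda>n. lam) \<longlonglongrightarrow> lam" by simp
    show "\<forall>\<^sub>F n in sequentially. lam - 1 / real n \<le> m n / n"
      using eventually_gt_at_top[of 0]
    proof eventually_elim
      case (elim n)
      then have "lam - 1 / real n = (lam * real n - 1) / n" by (simp add: field_simps)
      also have "\<dots> \<le> m n / n" by (intro divide_right_mono mb) auto
      finally show ?case .
    qed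
    show "\<forall>\<^sub>F n in sequentially. m n / n \<le> lam"
      using eventually_gt_at_top[of 0]
      by eventually_elim (use mb(2) in \<open>simp add: field_simps\<close>)
  qed
  have "eventually (\<lambda>n. 1 \<le> lam * real n - 1) sequentially"
    "eventually (\<lambda>n. lam * real n < real n * (real n - 1) / 2) sequentially"
    using assms(1) by real_asymp+
  then have ev: "eventually (\<lambda>n. 1 \<le> m n \<and> m n < n choose 2) sequentially"
  proof eventually_elim
    case (elim n)
    have "1 \<le> real (m n)" "real (m n) < real (n choose 2)"
      using elim mb[of n] unfolding real_choose_two by linarith+
    then show ?case by simp
  qed
  \<comment> \<open>\<open>u n\<close> is rewritten in terms of \<open>m n / n\<close> and
    \<open>1 / n\<close>, by cancelling the square of \<open>n\<close>.\<close>
  have "(\<lambda>n. (m n / n) / ((1 - 1 / real n) / 2 - (m n / n) * (1 / real n))) \<longlonglongrightarrow> lam / ((1 - 0) / 2 - lam * 0)"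
    by (intro tendsto_intros r lim_1_over_n) auto
  moreover have "eventually (\<lambda>n. (m n / n) / ((1 - 1 / real n) / 2 - (m n / n) * (1 / real n)) = u n) sequentially"
    using ev eventually_gt_at_top[of 0]
  proof eventually_elim
    case (elim n)
    define D where "D = (1 - 1 / real n) / 2 - (m n / n) * (1 / real n)"
    have "real ((n choose 2) - m n) = n * n * D"
      using elim by (simp add: D_def of_nat_diff real_choose_two field_simps)
    then have "u n = (m n / n) / D" unfolding u_def using elim by simp
    then show ?case by (simp add: D_def)
  qed
  ultimately have u: "u \<longlonglongrightarrow> 2 * lam"
    using Lim_transform_eventually by (fastforce simp: mult.commute)
  let ?g = "\<lambda>n. 2 * \<tau> / K + K * u n / n + u n * exp (- \<tau>) + ln (u n) + 1 / (2 * u n) - m n / n"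
  have lim: "(\<lambda>n. 2 * \<tau> / K + K * u n * (1 / real n) + u n * exp (- \<tau>) + ln (u n) + 1 / (2 * u n) - m n / n)
     \<longlonglongrightarrow> 2 * \<tau> / K + K * (2 * lam) * 0 + 2 * lam * exp (- \<tau>) + ln (2 * lam) + 1 / (2 * (2 * lam)) - lam"
    using assms(1) by (intro tendsto_intros u r lim_1_over_n) auto
  have eq: "2 * \<tau> / K + K * (2 * lam) * 0 + 2 * lam * exp (- \<tau>) + ln (2 * lam)
      + 1 / (2 * (2 * lam)) - lam = 2 * \<tau> / K + 2 * lam * exp (- \<tau>) - 8 * c"
  proof -
    have "8 * c = - (ln (2 * lam) + 1 / (2 * (2 * lam)) - 2 * lam / 2)" unfolding c_def by simp
    then show ?thesis by simp
  qed
  have "?g \<longlonglongrightarrow> 2 * \<tau> / K + 2 * lam * exp (- \<tau>) - 8 * c"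
    using lim unfolding eq by simp
  moreover have "2 * \<tau> / K + 2 * lam * exp (- \<tau>) - 8 * c < - c" using \<tau> Kc c by simp
  ultimately have g: "eventually (\<lambda>n. ?g n < - c) sequentially" by (rule order_tendstoD)
  have "(\<lambda>n. exp 2 * real n * real (m n) * exp (real n * ?g n)) \<longlonglongrightarrow> 0"
  proof (rule tendsto_sandwich)
    show "\<forall>\<^sub>F n in sequentially. 0 \<le> exp 2 * real n * real (m n) * exp (real n * ?g n)" by simp
    show "\<forall>\<^sub>F n in sequentially. exp 2 * real n * real (m n) * exp (real n * ?g n)
        \<le> exp 2 * real n * (lam * real n) * exp (real n * - c)"
      using g
    proof eventually_elim
      case (elim n)
      have "real n * ?g n \<le> real n * - c" using elim by (intro mult_left_mono) auto
      then show ?case using mb[of n] assms(1)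
        by (intro mult_mono mult_left_mono) auto
    qed
    show "(\<lambda>n. exp 2 * real n * (lam * real n) * exp (real n * - c)) \<longlonglongrightarrow> 0"
      using c by real_asymp
  qed simp
  then show thesis using that \<tau>(1) K(2) ev by blast
qed

section \<open>Transfer to the balanced model\<close>

theorem theorem3:
  fixes lam :: real
  assumes "lam > 1/2"
  shows "\<exists>f::real. f > 0 \<and>
    (\<forall>\<epsilon>::real. \<epsilon> > 0 \<longrightarrow> (\<exists>M::nat. \<forall>N::nat. \<forall>n::nat. N \<ge> 1 \<longrightarrow> n \<ge> M \<longrightarrow>
      measure_pmf.prob (balanced_model N n (nat \<lfloor>lam * real n\<rfloor>))
        {(E, es). avg_error N E es \<ge> f} \<ge> 1 - \<epsilon>))"
proof -
  define m where "m n = nat \<lfloor>lam * real n\<rfloor>" for n :: nat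
  define u where "u n = real n * real (m n) / real ((n choose 2) - m n)" for n :: nat
  obtain \<tau> :: real and K :: nat where \<tau>: "\<tau> \<ge> 0" and K: "K > 0" and
    lim: "(\<lambda>n. exp 2 * real n * real (m n) * exp (real n *
        (2 * \<tau> / K + K * u n / n + u n * exp (- \<tau>) + ln (u n) + 1 / (2 * u n) - m n / n))) \<longlonglongrightarrow> 0"
    and ev: "eventually (\<lambda>n. 1 \<le> m n \<and> m n < n choose 2) sequentially"
    using low_excess_bound_tendsto_0[OF assms] unfolding m_def u_def by blast
  \<comment> \<open>An excess of \<open>n / K\<close>, divided by twice the number of edges, which
    is at most \<open>lam * n\<close>.\<close>
  define f where "f = 1 / (2 * K * lam)"
  show ?thesis
  proof (intro exI[of _ f] conjI allI impI)
    show "f > 0" using assms K by (simp add: f_def)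
    fix \<epsilon> :: real assume "\<epsilon> > 0"
    from order_tendstoD(2)[OF lim this] ev eventually_ge_at_top[of 1]
    have "eventually (\<lambda>n. \<forall>N\<ge>1. 1 - \<epsilon> \<le>
        measure_pmf.prob (balanced_model N n (m n)) {(E, es). avg_error N E es \<ge> f}) sequentially"
    proof eventually_elim
      case (elim n)
      show ?case
      proof (intro allI impI)
        fix N :: nat assume N: "N \<ge> 1"
        define G where "G = graphs_with_edges {1..n} (m n)"
        define bad where "bad = {E\<in>G. \<forall>S\<subseteq>{1..n}. real (card {e\<in>E. e \<subseteq> S}) - real (card S) < n / K}"
        have G: "finite G" "card G = (n choose 2) choose m n"
          unfolding G_def graphs_with_edges_def by (simp_all add: n_subsets finite_imp_finite_nsets card_nsets)
        then have "G \<noteq> {}" using elim by auto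
        have "card bad / card G \<le> exp 2 * real n * real (m n) * exp (real n *
            (2 * \<tau> / K + K * u n / n + u n * exp (- \<tau>) + ln (u n) + 1 / (2 * u n) - m n / n))"
          unfolding G(2) unfolding bad_def G_def u_def
          using elim \<tau> K by (intro low_excess_fraction_le) auto
        also have "\<dots> < \<epsilon>" using elim by blast
        finally have frac: "card bad / card G < \<epsilon>" .
        have "1 - \<epsilon> \<le> 1 - measure_pmf.prob (random_graph n (m n)) bad"
        proof -
          have "G \<inter> bad = bad" by (auto simp: bad_def)
          then show ?thesis
            using frac G(1) \<open>G \<noteq> {}\<close>
            unfolding random_graph_def G_def[symmetric] by (simp add: measure_pmf_of_set)
        qed
        also have "\<dots> = measure_pmf.prob (random_graph n (m n)) (- bad)"
          using measure_pmf.prob_compl[of bad "random_graph n (m n)"] by (simp add: Compl_eq_Diff_UNIV)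
        \<comment> \<open>The first marginal is the random graph for every \<open>N\<close>, which
          makes the threshold for \<open>n\<close> uniform in \<open>N\<close>.\<close>
        also have "random_graph n (m n) = map_pmf fst (balanced_model N n (m n))"
          by (simp add: balanced_model_def map_bind_pmf pmf.map_comp o_def bind_return_pmf' map_pmf_const)
        also have "measure_pmf.prob \<dots> (- bad)
            = measure_pmf.prob (balanced_model N n (m n)) (fst -` (- bad))" by simp
        also have "\<dots> \<le> measure_pmf.prob (balanced_model N n (m n)) {(E, es). avg_error N E es \<ge> f}"
        \<comment> \<open>The excess bound holds for every sequence in the support, so it suffices
          that the graph lies outside \<open>bad\<close>.\<close>
        proof (rule measure_pmf.finite_measure_mono_AE)
          show "AE x in measure_pmf (balanced_model N n (m n)).
             x \<in> fst -` (- bad) \<longrightarrow> x \<in> {(E, es). avg_error N E es \<ge> f}"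
          proof (intro AE_pmfI impI)
            fix x assume x: "x \<in> set_pmf (balanced_model N n (m n))" "x \<in> fst -` (- bad)"
            obtain E es where E_es: "x = (E, es)" by (cases x)
            with x have supp: "(E, es) \<in> set_pmf (balanced_model N n (m n))" and "E \<notin> bad"
              by simp_all
            have E: "E \<in> G" and es: "es \<in> permutations_of_multiset (repeat_mset N (mset_set E))"
              using supp G(1) \<open>G \<noteq> {}\<close>
              unfolding balanced_model_def balanced_sequence_def random_graph_def G_def[symmetric]
              by (auto simp: permutations_of_multiset_nonempty)
            have "finite E" "card E = m n" "\<And>e. e \<in> E \<Longrightarrow> card e = 2"
              using E elim by (auto simp: G_def graphs_with_edges_def nsets_def intro: card_ge_0_finite)
            from E \<open>E \<notin> bad\<close> obtain S where S: "S \<subseteq> {1..n}"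
              "n / K \<le> real (card {e\<in>E. e \<subseteq> S}) - real (card S)"
              by (force simp: bad_def not_less)
            have mn: "0 < real (m n)" "real (m n) \<le> lam * n"
              using elim assms by (simp, simp add: m_def)
            have "f \<le> n / K / (2 * real (m n))"
              using mn K assms by (simp add: f_def field_simps)
            also have "\<dots> \<le> (real (card {e\<in>E. e \<subseteq> S}) - real (card S)) / (2 * real (card E))"
              unfolding \<open>card E = m n\<close> using S(2) by (intro divide_right_mono) auto
            also have "\<dots> \<le> avg_error N E es"
              using finite_subset[OF S(1)] \<open>\<And>e. e \<in> E \<Longrightarrow> card e = 2\<close>
              by (intro avg_error_ge_excess \<open>finite E\<close> N es) auto
            finally show "x \<in> {(E, es). avg_error N E es \<ge> f}" by (simp add: E_es)
          qed
        qed simp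
        finally show "1 - \<epsilon> \<le> measure_pmf.prob (balanced_model N n (m n)) {(E, es). avg_error N E es \<ge> f}" .
      qed
    qed
    then show "\<exists>M. \<forall>N n. 1 \<le> N \<longrightarrow> M \<le> n \<longrightarrow> 1 - \<epsilon> \<le>
        measure_pmf.prob (balanced_model N n (nat \<lfloor>lam * real n\<rfloor>)) {(E, es). avg_error N E es \<ge> f}"
      unfolding eventually_sequentially m_def by blast
  qed
qed

end
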